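(* Let $(X, \beta)$ be a metric space with $\sup\{\beta(x,y) : x, y \in X\} > 0$ (the supremum may be $\infty$), and let $f : X \to \mathbb{C}$ be a function. Then $f \in Lip_c(X)$ if and only if for every real $\epsilon > 0$ there is a real constant $C = C(\epsilon) > 0$ such that $$|f(x) - f(y)| < \epsilon + C(\epsilon)\,\beta(x,y)$$ for all $x, y \in X$.
   Context: For a metric space $(X,\beta)$, $Lip(X)$ denotes the set of all functions $g : X \to \mathbb{C}$ for which there is a constant $C = C(g) > 0$ with $|g(x) - g(y)| \le C\,\beta(x,y)$ for all $x, y \in X$. Functions in $Lip(X)$ are not required to be bounded. $Lip_c(X)$ denotes the uniform closure of $Lip(X)$: the set of all functions $f : X \to \mathbb{C}$ such that for every $\epsilon > 0$ there is $g \in Lip(X)$ with $|f(x) - g(x)| < \epsilon$ for all $x \in X$. *)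

theory Defs
  imports "HOL-Analysis.Analysis"
begin

text \<open>
  A function on the metric space \<open>(X, \<beta>)\<close> is represented by a total function on the ambient
  type, of which only the values on the carrier \<open>X\<close> matter.
\<close>

definition Lip :: "'a set \<Rightarrow> ('a \<Rightarrow> 'a \<Rightarrow> real) \<Rightarrow> ('a \<Rightarrow> complex) set" where
  "Lip X \<beta> = {g. \<exists>C>0. \<forall>x\<in>X. \<forall>y\<in>X. cmod (g x - g y) \<le> C * \<beta> x y}"

definition Lip_c :: "'a set \<Rightarrow> ('a \<Rightarrow> 'a \<Rightarrow> real) \<Rightarrow> ('a \<Rightarrow> complex) set" where
  "Lip_c X \<beta> = {f. \<forall>\<epsilon>>0. \<exists>g\<in>Lip X \<beta>. \<forall>x\<in>X. cmod (f x - g x) < \<epsilon>}"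

end

theory Submission
  imports Defs
begin

text \<open>
  A uniform limit of Lipschitz functions satisfies the estimate by the triangle inequality: compare
  \<open>f\<close> with a Lipschitz function at distance less than \<open>\<epsilon>/2\<close> at both points. For the converse, the
  estimate says that \<open>f\<close> is Lipschitz up to an additive error \<open>e\<close>. For a real function \<open>u\<close> with
  this property, the infimal convolution \<open>h x = (INF y\<in>X. u y + C * \<beta> x y)\<close> of McShane is
  Lipschitz, being an infimum of functions that are Lipschitz with the same constant \<open>C\<close>. It lies
  below \<open>u\<close> (take \<open>y = x\<close>), and the estimate for \<open>u\<close> is exactly what prevents it from dropping
  below \<open>u - e\<close>. A complex function is approximated through its real and imaginary parts.
\<close>

text \<open>
  The witness is the infimal convolution of \<open>u\<close> with \<open>C * \<beta>\<close>. The hypothesis on \<open>u\<close> enters twice: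
  it makes the infimum finite, and it limits how far the infimum can fall below \<open>u\<close>.
\<close>

lemma Lipschitz_approximation_of_almost_Lipschitz:
  fixes u :: "'a \<Rightarrow> real"
  assumes "Metric_space X \<beta>" and "C \<ge> 0"
    and almost: "\<And>x y. x \<in> X \<Longrightarrow> y \<in> X \<Longrightarrow> u x - u y \<le> e + C * \<beta> x y"
  obtains h :: "'a \<Rightarrow> real"
  where "\<And>x y. x \<in> X \<Longrightarrow> y \<in> X \<Longrightarrow> \<bar>h x - h y\<bar> \<le> C * \<beta> x y"
    and "\<And>x. x \<in> X \<Longrightarrow> \<bar>u x - h x\<bar> \<le> e"
proof -
  interpret Metric_space X \<beta> by fact
  define h where "h x = (INF y\<in>X. u y + C * \<beta> x y)" for x
  have bdd: "bdd_below ((\<lambda>y. u y + C * \<beta> x y) ` X)" if "x \<in> X" for x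
    using almost[OF that] by (intro bdd_belowI2[of _ "u x - e"]) (simp add: algebra_simps)
  have one_sided: "h x - h z \<le> C * \<beta> x z" if x: "x \<in> X" and z: "z \<in> X" for x z
  proof -
    have "h x - C * \<beta> x z \<le> u y + C * \<beta> z y" if y: "y \<in> X" for y
    proof -
      have "h x \<le> u y + C * \<beta> x y"
        unfolding h_def by (rule cINF_lower[OF bdd[OF x] y])
      moreover have "C * \<beta> x y \<le> C * (\<beta> x z + \<beta> z y)"
        using triangle[OF x z y] \<open>C \<ge> 0\<close> by (rule mult_left_mono)
      ultimately show ?thesis by (simp add: algebra_simps)
    qed
    then have "h x - C * \<beta> x z \<le> h z"
      unfolding h_def[of z] using z by (intro cINF_greatest) auto
    then show ?thesis by simp
  qed
  have "\<bar>h x - h z\<bar> \<le> C * \<beta> x z" if "x \<in> X" "z \<in> X" for x z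
    using one_sided[OF that] one_sided[OF that(2,1)] by (simp add: commute[of z x] abs_le_iff)
  moreover have "\<bar>u x - h x\<bar> \<le> e" if x: "x \<in> X" for x
  proof -
    have "h x \<le> u x + C * \<beta> x x"
      unfolding h_def by (rule cINF_lower[OF bdd[OF x] x])
    then have "h x \<le> u x" using x by simp
    moreover have "u x - e \<le> u y + C * \<beta> x y" if "y \<in> X" for y
      using almost[OF x that] by simp
    then have "u x - e \<le> h x"
      unfolding h_def using x by (intro cINF_greatest) auto
    ultimately show ?thesis by simp
  qed
  ultimately show ?thesis by (rule that)
qed

theorem theorem1:
  fixes X :: "'a set" and \<beta> :: "'a \<Rightarrow> 'a \<Rightarrow> real" and f :: "'a \<Rightarrow> complex"
  assumes "Metric_space X \<beta>"
    and "Sup {ereal (\<beta> x y) | x y. x \<in> X \<and> y \<in> X} > 0"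
  shows "f \<in> Lip_c X \<beta> \<longleftrightarrow>
    (\<forall>\<epsilon>::real. \<epsilon> > 0 \<longrightarrow>
      (\<exists>C::real. C > 0 \<and> (\<forall>x\<in>X. \<forall>y\<in>X. cmod (f x - f y) < \<epsilon> + C * \<beta> x y)))"
proof
  assume f: "f \<in> Lip_c X \<beta>"
  show "\<forall>\<epsilon>::real. \<epsilon> > 0 \<longrightarrow>
      (\<exists>C::real. C > 0 \<and> (\<forall>x\<in>X. \<forall>y\<in>X. cmod (f x - f y) < \<epsilon> + C * \<beta> x y))"
  proof (intro allI impI)
    fix \<epsilon> :: real assume "\<epsilon> > 0"
    then obtain g where "g \<in> Lip X \<beta>" and close: "\<forall>x\<in>X. cmod (f x - g x) < \<epsilon> / 2"
      using f unfolding Lip_c_def by (auto dest: spec[of _ "\<epsilon> / 2"])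
    then obtain C where "C > 0" and lip: "\<forall>x\<in>X. \<forall>y\<in>X. cmod (g x - g y) \<le> C * \<beta> x y"
      unfolding Lip_def by auto
    have "cmod (f x - f y) < \<epsilon> + C * \<beta> x y" if "x \<in> X" "y \<in> X" for x y
    proof -
      have "cmod (f x - f y) = cmod ((f x - g x) + (g x - g y) - (f y - g y))"
        by simp
      also have "\<dots> \<le> cmod (f x - g x) + cmod (g x - g y) + cmod (f y - g y)"
        by (meson norm_triangle_ineq norm_triangle_ineq4 add_right_mono order_trans)
      also have "\<dots> < \<epsilon> / 2 + C * \<beta> x y + \<epsilon> / 2"
        using that close lip by (intro add_less_le_mono add_le_less_mono add_strict_mono) auto
      finally show ?thesis by simp
    qed
    with \<open>C > 0\<close> show "\<exists>C>0. \<forall>x\<in>X. \<forall>y\<in>X. cmod (f x - f y) < \<epsilon> + C * \<beta> x y"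
      by blast
  qed
next
  assume almost: "\<forall>\<epsilon>::real. \<epsilon> > 0 \<longrightarrow>
      (\<exists>C::real. C > 0 \<and> (\<forall>x\<in>X. \<forall>y\<in>X. cmod (f x - f y) < \<epsilon> + C * \<beta> x y))"
  show "f \<in> Lip_c X \<beta>"
    unfolding Lip_c_def
  proof (intro CollectI allI impI)
    fix \<epsilon> :: real assume "\<epsilon> > 0"
    \<comment> \<open>A quarter for each of the two parts gives at most \<open>\<epsilon>/2\<close>, so the final bound is strict.\<close>
    then obtain C where "C > 0"
      and C: "\<And>x y. x \<in> X \<Longrightarrow> y \<in> X \<Longrightarrow> cmod (f x - f y) < \<epsilon> / 4 + C * \<beta> x y"
      using almost[rule_format, of "\<epsilon> / 4"] by auto
    have "Re (f x) - Re (f y) \<le> \<epsilon> / 4 + C * \<beta> x y"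
         "Im (f x) - Im (f y) \<le> \<epsilon> / 4 + C * \<beta> x y" if "x \<in> X" "y \<in> X" for x y
      using C[OF that] complex_Re_le_cmod[of "f x - f y"] abs_Im_le_cmod[of "f x - f y"] by auto
    note parts = this
    obtain a where a_lip: "\<And>x y. x \<in> X \<Longrightarrow> y \<in> X \<Longrightarrow> \<bar>a x - a y\<bar> \<le> C * \<beta> x y"
      and a_close: "\<And>x. x \<in> X \<Longrightarrow> \<bar>Re (f x) - a x\<bar> \<le> \<epsilon> / 4"
      using Lipschitz_approximation_of_almost_Lipschitz[of X \<beta> C "\<lambda>x. Re (f x)" "\<epsilon> / 4"]
        assms(1) \<open>C > 0\<close> parts(1) by (metis less_imp_le)
    obtain b where b_lip: "\<And>x y. x \<in> X \<Longrightarrow> y \<in> X \<Longrightarrow> \<bar>b x - b y\<bar> \<le> C * \<beta> x y"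
      and b_close: "\<And>x. x \<in> X \<Longrightarrow> \<bar>Im (f x) - b x\<bar> \<le> \<epsilon> / 4"
      using Lipschitz_approximation_of_almost_Lipschitz[of X \<beta> C "\<lambda>x. Im (f x)" "\<epsilon> / 4"]
        assms(1) \<open>C > 0\<close> parts(2) by (metis less_imp_le)
    define g where "g x = Complex (a x) (b x)" for x
    have "cmod (g x - g y) \<le> (2 * C) * \<beta> x y" if "x \<in> X" "y \<in> X" for x y
      using cmod_le[of "g x - g y"] a_lip[OF that] b_lip[OF that] by (simp add: g_def)
    with \<open>C > 0\<close> have "g \<in> Lip X \<beta>"
      unfolding Lip_def by (auto intro!: exI[of _ "2 * C"])
    moreover have "cmod (f x - g x) < \<epsilon>" if "x \<in> X" for x
      using cmod_le[of "f x - g x"] a_close[OF that] b_close[OF that] \<open>\<epsilon> > 0\<close>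
      by (simp add: g_def)
    ultimately show "\<exists>g\<in>Lip X \<beta>. \<forall>x\<in>X. cmod (f x - g x) < \<epsilon>"
      by blast
  qed
qed

end
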